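(* There is no function $\psi:T\to\mathbb{C}$ such that $M_\psi$ is an isometry from $\mathcal{L}$ to $\mathcal{L}_{\mathbf{w}}$, and there is no function $\psi:T\to\mathbb{C}$ such that $M_\psi$ is an isometry from $\mathcal{L}_0$ to $\mathcal{L}_{\mathbf{w},0}$.
   Context: $T$ is the vertex set of a tree (a locally finite, connected, simply connected graph), rooted at a vertex $o$ and without terminal vertices (a terminal vertex is one having a unique neighbor), hence infinite. $|v|$ is the number of edges in the path from $o$ to $v$; $T^*=T\setminus\{o\}$; for $v\in T^*$, $v^-$ is the neighbor of $v$ closest to $o$. For $f:T\to\mathbb{C}$ and $v\in T^*$, $Df(v)=|f(v)-f(v^-)|$. The Lipschitz space $\mathcal{L}$ is the Banach space of all $f:T\to\mathbb{C}$ with $\sup_{v\in T^*}Df(v)<\infty$, with norm $\|f\|_{\mathcal{L}}=|f(o)|+\sup_{v\in T^*}Df(v)$; the little Lipschitz space is the closed subspace $\mathcal{L}_0=\{f\in\mathcal{L}:\lim_{|v|\to\infty}Df(v)=0\}$. The weighted Lipschitz space $\mathcal{L}_{\mathbf{w}}$ is the Banach space of all $f:T\to\mathbb{C}$ with $\sup_{v\in T^*}|v|Df(v)<\infty$, with norm $\|f\|_{\mathbf{w}}=|f(o)|+\sup_{v\in T^*}|v|Df(v)$; the little weighted Lipschitz space is the closed subspace $\mathcal{L}_{\mathbf{w},0}=\{f\in\mathcal{L}_{\mathbf{w}}:\lim_{|v|\to\infty}|v|Df(v)=0\}$. For $\psi:T\to\mathbb{C}$, $M_\psi f=\psi f$ (pointwise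 product). $M_\psi$ is an isometry from $X$ to $Y$ if $\psi f\in Y$ and $\|\psi f\|_Y=\|f\|_X$ for all $f\in X$. *)

theory Defs
  imports Complex_Main "Graph_Theory.Digraph_Component"
begin

text \<open>
  Undirected graphs are symmetric loop-free digraphs without parallel arcs.  In such a digraph the
  walk \<open>u, v, u\<close> along the two arcs of one edge is a \<open>cycle\<close> in the sense of the library, so
  simple connectivity only excludes cycles with at least three arcs; for the same reason the
  library predicate \<open>tree\<close> is of no use here.  The graph with a single vertex has no terminal
  vertex either; it is excluded by \<open>infinite_verts\<close>.
\<close>

locale rooted_tree = pair_bidirected_digraph G for G :: "'a pair_pre_digraph" +
  fixes root :: 'a
  assumes root_in_verts: "root \<in> pverts G"
    and connected: "Digraph_Component.connected (with_proj G)"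
    and simply_connected: "\<not> (\<exists>p. cycle p \<and> 3 \<le> length p)"
    and locally_finite: "v \<in> pverts G \<Longrightarrow> finite {u. v \<rightarrow>\<^bsub>with_proj G\<^esub> u}"
    and no_terminal: "v \<in> pverts G \<Longrightarrow> \<not> (\<exists>!u. v \<rightarrow>\<^bsub>with_proj G\<^esub> u)"
    and infinite_verts: "infinite (pverts G)"
begin

definition depth :: "'a \<Rightarrow> nat" where
  "depth v = length (THE p. apath root p v)"

definition pred :: "'a \<Rightarrow> 'a" where
  "pred v = (ARG_MIN depth u. v \<rightarrow>\<^bsub>with_proj G\<^esub> u)"

text \<open>
  Functions on the tree are functions on the whole type \<open>'a\<close> whose values outside \<open>pverts G\<close> are
  irrelevant.  The value of \<open>D f\<close> at the root carries no meaning and has no influence on the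
  spaces and norms below.
\<close>

definition D :: "('a \<Rightarrow> complex) \<Rightarrow> 'a \<Rightarrow> real" where
  "D f v = cmod (f v - f (pred v))"

definition at_boundary :: "'a filter" where
  "at_boundary = inf (filtercomap depth at_top) (principal (pverts G))"

definition lip :: "('a \<Rightarrow> complex) set" where
  "lip = {f. bdd_above (D f ` (pverts G - {root}))}"

definition lip_norm :: "('a \<Rightarrow> complex) \<Rightarrow> real" where
  "lip_norm f = cmod (f root) + (SUP v\<in>pverts G - {root}. D f v)"

definition little_lip :: "('a \<Rightarrow> complex) set" where
  "little_lip = {f \<in> lip. (D f \<longlongrightarrow> 0) at_boundary}"

definition wlip :: "('a \<Rightarrow> complex) set" where
  "wlip = {f. bdd_above ((\<lambda>v. real (depth v) * D f v) ` (pverts G - {root}))}"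

definition wlip_norm :: "('a \<Rightarrow> complex) \<Rightarrow> real" where
  "wlip_norm f = cmod (f root) + (SUP v\<in>pverts G - {root}. real (depth v) * D f v)"

definition little_wlip :: "('a \<Rightarrow> complex) set" where
  "little_wlip = {f \<in> wlip. ((\<lambda>v. real (depth v) * D f v) \<longlongrightarrow> 0) at_boundary}"

end

definition mult_op :: "('a \<Rightarrow> complex) \<Rightarrow> ('a \<Rightarrow> complex) \<Rightarrow> 'a \<Rightarrow> complex" where
  "mult_op \<psi> f = (\<lambda>v. \<psi> v * f v)"

definition isometry_between ::
  "('b \<Rightarrow> 'b) \<Rightarrow> 'b set \<Rightarrow> ('b \<Rightarrow> real) \<Rightarrow> 'b set \<Rightarrow> ('b \<Rightarrow> real) \<Rightarrow> bool" where
  "isometry_between M X normX Y normY \<longleftrightarrow> (\<forall>f\<in>X. M f \<in> Y \<and> normY (M f) = normX f)"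

end

theory Submission
  imports Defs
begin

text \<open>
  The indicator of the root forces \<open>\<bar>\<psi>(o)\<bar> = 1\<close>, and then the constant function \<open>1\<close>, of norm \<open>1\<close>,
  forces \<open>D \<psi> = 0\<close>, so \<open>\<bar>\<psi>\<bar> = 1\<close> throughout.  But the indicator of a vertex at depth \<open>2\<close> has
  norm \<open>1\<close> in the Lipschitz space, while its image has weighted norm at least \<open>2\<close>.  All these test
  functions lie in the little Lipschitz space, so both claims are settled at once.
\<close>

context rooted_tree
begin

section \<open>Unique paths and the depth function\<close>

lemma reachable_verts:
  assumes "u \<in> pverts G" "v \<in> pverts G"
  shows "\<exists>p. apath u p v"
proof -
  have "strongly_connected (with_proj G)"
    using symmetric_connected_imp_strongly_connected pair_sym_arcs connected by blast
  then show ?thesis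
    using assms reachable_apath unfolding strongly_connected_def by simp
qed

text \<open>Two paths that leave \<open>u\<close> by the same arc are compared by induction on their
  tails; different first arcs would produce a cycle that simple connectivity forbids. This makes the
  \<open>THE\<close> in \<open>depth\<close> well defined.\<close>

lemma apath_unique:
  assumes "apath u p v" "apath u q v"
  shows "p = q"
  using assms
proof (induction p arbitrary: u q)
  case Nil
  then show ?case
    by (metis apath_Nil_iff apath_nonempty_ends)
next
  case (Cons a p)
  obtain x where a: "a = (u, x)" and ux: "(u, x) \<in> parcs G" and p: "apath x p v"
    and up: "u \<notin> set (awalk_verts x p)"
    using Cons.prems(1) by (cases a) (auto simp: apath_Cons_iff)
  have "q \<noteq> []"
    using Cons.prems by (metis apath_Nil_iff apath_nonempty_ends list.discI)
  then obtain b q' where q: "q = b # q'"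
    by (cases q) auto
  obtain y where b: "b = (u, y)" and uy: "(u, y) \<in> parcs G" and q': "apath y q' v"
    and uq: "u \<notin> set (awalk_verts y q')"
    using Cons.prems(2) q by (cases b) (auto simp: apath_Cons_iff)
  have "x = y"
  proof (rule ccontr)
    assume "x \<noteq> y"
    \<comment> \<open>A walk from \<open>x\<close> to \<open>y\<close> avoiding \<open>u\<close> is shortened to a path, which \<open>u\<close> closes to a cycle.\<close>
    let ?w = "p @ rev_path q'"
    have wp: "awalk x p v" and wq: "awalk v (rev_path q') y"
      using p q' by (auto simp: apath_def)
    then have w: "awalk x ?w y"
      by (simp add: awalk_appendI)
    have "set (awalk_verts v (rev_path q')) = set (awalk_verts y q')"
      using q' by (simp add: awalk_verts_rev_path[OF awalkI_apath])
    then have uw: "u \<notin> set (awalk_verts x ?w)"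
      using up uq w set_awalk_verts_append[OF wp wq] by auto
    define r where "r = awalk_to_apath ?w"
    have r: "apath x r y" and sub: "set r \<subseteq> set ?w"
      using apath_awalk_to_apath[OF w] awalk_to_apath_subset[OF w] by (auto simp: r_def)
    \<comment> \<open>The vertices of a walk are its start and the ends of its arcs, so shortening
      creates no new ones.\<close>
    have "set (awalk_verts x r) \<subseteq> set (awalk_verts x ?w)"
      unfolding set_awalk_verts[OF w] set_awalk_verts[OF awalkI_apath[OF r]]
      unfolding set_map using sub by (intro Un_mono image_mono subset_refl)
    with uw have ur: "u \<notin> set (awalk_verts x r)"
      by (rule contra_subsetD[rotated])
    \<comment> \<open>At least one arc between \<open>x\<close> and \<open>y\<close> makes the cycle
      through \<open>u\<close> at least three arcs long, so that it is not a single edge walked back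
      and forth.\<close>
    have "r \<noteq> []"
      using r \<open>x \<noteq> y\<close> by (auto simp: apath_Nil_iff)
    have yu: "(y, u) \<in> parcs G"
      using uy by (rule arcs_symmetric)
    have wr: "awalk x r y"
      using r by (rule awalkI_apath)
    have e: "awalk y [(y, u)] u"
      using yu by (auto simp: awalk_simps intro: in_arcsD2)
    have re: "awalk x (r @ [(y, u)]) u"
      using wr e by (rule awalk_appendI)
    then have "awalk u ((u, x) # r @ [(y, u)]) u"
      unfolding awalk_Cons_iff using ux by (intro conjI) (simp_all only: fst_conv snd_conv)
    moreover have "awalk_verts x (r @ [(y, u)]) = awalk_verts x r @ [u]"
      using awalk_verts_append[OF re] wr by simp
    then have "distinct (tl (awalk_verts u ((u, x) # r @ [(y, u)])))"
      using r ur by (simp add: apath_def)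
    ultimately have "cycle ((u, x) # r @ [(y, u)])"
      unfolding cycle_def by blast
    moreover have "3 \<le> length ((u, x) # r @ [(y, u)])"
      using \<open>r \<noteq> []\<close> by (cases r) auto
    ultimately show False
      using simply_connected by blast
  qed
  then show ?case
    using Cons.IH p q' a b q by blast
qed

lemma depth_eq: "apath root p v \<Longrightarrow> depth v = length p"
  unfolding depth_def using apath_unique by (metis the_equality)

lemma depth_root: "depth root = 0"
  using depth_eq[of "[]"] root_in_verts by (simp add: apath_Nil_iff)

lemma depth_0D: "v \<in> pverts G \<Longrightarrow> depth v = 0 \<Longrightarrow> v = root"
  using reachable_verts[OF root_in_verts, of v] depth_eq by (force simp: apath_Nil_iff)

lemma depth_1_iff:
  assumes "v \<in> pverts G"
  shows "depth v = 1 \<longleftrightarrow> (root, v) \<in> parcs G"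
proof
  assume d: "depth v = 1"
  obtain p where p: "apath root p v"
    using reachable_verts[OF root_in_verts assms] by blast
  with d obtain e where "p = [e]"
    using depth_eq by (auto simp: length_Suc_conv)
  with p show "(root, v) \<in> parcs G"
    by (cases e) (auto simp: apath_simps)
next
  assume "(root, v) \<in> parcs G"
  then have "apath root [(root, v)] v"
    using no_loops' in_arcsD2 by (auto simp: apath_simps)
  then show "depth v = 1"
    using depth_eq by fastforce
qed

section \<open>Neighbours and predecessors\<close>

lemma ex_neighbor:
  assumes "v \<in> pverts G"
  shows "\<exists>u. (v, u) \<in> parcs G"
proof -
  obtain w where "w \<in> pverts G" "w \<noteq> v"
    using infinite_verts by (metis finite.emptyI finite_insert finite_subset insertI1 subsetI)
  then obtain p where "apath v p w" "p \<noteq> []"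
    using reachable_verts assms by (metis apath_Nil_iff)
  then show ?thesis
    by (cases p) (auto simp: apath_Cons_iff)
qed

text \<open>A minimum over natural numbers is attained as soon as one neighbour exists, so
  \<open>ARG_MIN\<close> returns a neighbour of least depth.\<close>

lemma
  assumes "(v, u) \<in> parcs G"
  shows pred_arc': "(v, pred v) \<in> parcs G" and depth_pred_le: "depth (pred v) \<le> depth u"
  using arg_min_nat_lemma[of "\<lambda>u. (v, u) \<in> parcs G" u depth] assms
  by (auto simp: pred_def)

lemma pred_arc: "v \<in> pverts G \<Longrightarrow> (v, pred v) \<in> parcs G"
  using ex_neighbor pred_arc' by blast

lemma pred_neighbor_root:
  assumes "(root, v) \<in> parcs G"
  shows "pred v = root"
proof -
  have v: "(v, root) \<in> parcs G"
    using assms by (rule arcs_symmetric)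
  then have "depth (pred v) = 0"
    using depth_pred_le depth_root by fastforce
  then show ?thesis
    using depth_0D in_arcsD2 pred_arc'[OF v] by blast
qed

lemma depth_2_exists:
  obtains v where "v \<in> pverts G" "depth v = 2" "pred (pred v) = root" "pred v \<noteq> root"
proof -
  obtain u where u: "(root, u) \<in> parcs G"
    using ex_neighbor root_in_verts by blast
  have uV: "u \<in> pverts G" and ur: "(u, root) \<in> parcs G"
    using u in_arcsD2 arcs_symmetric by blast+
  then obtain v where v: "(u, v) \<in> parcs G" "v \<noteq> root"
    using no_terminal[of u] by auto
  have vV: "v \<in> pverts G" and vu: "(v, u) \<in> parcs G"
    using v in_arcsD2 arcs_symmetric by blast+
  have "apath root [(root, u), (u, v)] v"
    using u v vV no_loops' by (auto simp: apath_simps)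
  then have dv: "depth v = 2"
    using depth_eq by fastforce
  have pV: "pred v \<in> pverts G"
    using pred_arc[OF vV] in_arcsD2 by blast
  have pr: "pred v \<noteq> root"
    using pred_arc[OF vV] arcs_symmetric depth_1_iff[OF vV] dv by fastforce
  \<comment> \<open>The neighbour \<open>u\<close> competes in the minimum defining
    \<open>pred v\<close>, which bounds the depth without identifying \<open>pred v\<close> with
    \<open>u\<close>.\<close>
  have "depth (pred v) \<le> 1"
    using depth_pred_le[OF vu] depth_1_iff[OF uV] u by simp
  then have "depth (pred v) = 1"
    using depth_0D[OF pV] pr by linarith
  then have "pred (pred v) = root"
    using depth_1_iff[OF pV] pred_neighbor_root by blast
  with vV dv pr show thesis
    using that by blast
qed

section \<open>Test functions in the little Lipschitz space\<close>

lemma D_of_bool_le_1: "D (\<lambda>u. of_bool (u = x)) v \<le> 1"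
  by (simp add: D_def)

text \<open>\<open>D\<close> of the indicator vanishes off \<open>x\<close> and its neighbours,
  which by local finiteness have bounded depth.\<close>

lemma of_bool_in_little_lip: "x \<in> pverts G \<Longrightarrow> (\<lambda>u. of_bool (u = x)) \<in> little_lip"
proof -
  let ?f = "\<lambda>u. of_bool (u = x) :: complex"
  assume x: "x \<in> pverts G"
  let ?S = "insert x {u. (x, u) \<in> parcs G}"
  have "finite ?S"
    using locally_finite[OF x] by simp
  then obtain N where N: "\<And>v. v \<in> ?S \<Longrightarrow> depth v < N"
    using finite_nat_set_iff_bounded[of "depth ` ?S"] by auto
  have "D ?f v = 0" if "v \<in> pverts G" "depth v \<ge> N" for v
  proof -
    have "v \<notin> ?S"
      using N that by fastforce
    \<comment> \<open>This excludes \<open>pred v = x\<close>, since \<open>v\<close> would then be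
      a neighbour of \<open>x\<close> and lie in \<open>?S\<close>.\<close>
    moreover have "(pred v, v) \<in> parcs G"
      using that pred_arc arcs_symmetric by blast
    ultimately show ?thesis
      by (auto simp: D_def)
  qed
  then have "eventually (\<lambda>v. D ?f v = 0) at_boundary"
    unfolding at_boundary_def eventually_inf_principal eventually_filtercomap_at_top_linorder
    by blast
  then have "(D ?f \<longlongrightarrow> 0) at_boundary"
    by (rule tendsto_eventually)
  then show ?thesis
    using D_of_bool_le_1 by (auto simp: little_lip_def lip_def intro!: bdd_aboveI2[where M = 1])
qed

lemma D_root_indicator:
  assumes "v \<in> pverts G" "v \<noteq> root"
  shows "D (\<lambda>u. c * of_bool (u = root)) v = (if (root, v) \<in> parcs G then cmod c else 0)"
  using assms pred_arc[of v] pred_neighbor_root[of v] arcs_symmetric by (auto simp: D_def)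

lemma const_1_in_little_lip: "(\<lambda>_. 1) \<in> little_lip"
proof -
  have "D (\<lambda>_. 1) = (\<lambda>_. 0)"
    by (simp add: D_def fun_eq_iff)
  then show ?thesis
    by (auto simp: little_lip_def lip_def intro!: bdd_aboveI2[where M = 0])
qed

section \<open>Norm estimates and the contradiction\<close>

lemma verts_nonroot_nonempty: "pverts G - {root} \<noteq> {}"
  using infinite_verts by (metis finite.emptyI infinite_remove)

lemma wlip_norm_ge:
  assumes "f \<in> wlip" "v \<in> pverts G" "v \<noteq> root"
  shows "cmod (f root) + real (depth v) * D f v \<le> wlip_norm f"
  using assms unfolding wlip_def wlip_norm_def by (auto intro!: cSUP_upper)

lemma lip_norm_ge:
  assumes "f \<in> lip" "v \<in> pverts G" "v \<noteq> root"
  shows "cmod (f root) + D f v \<le> lip_norm f"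
  using assms unfolding lip_def lip_norm_def by (auto intro!: cSUP_upper)

text \<open>Smaller domain and larger codomain: an isometry of either kind in the theorem is also
  one of this kind.\<close>

lemma no_isometry_little_lip_wlip:
  assumes iso: "isometry_between (mult_op \<psi>) little_lip lip_norm wlip wlip_norm"
  shows False
proof -
  have W: "(\<lambda>u. \<psi> u * f u) \<in> wlip" and N: "wlip_norm (\<lambda>u. \<psi> u * f u) = lip_norm f"
    if "f \<in> little_lip" for f
    using iso[unfolded isometry_between_def mult_op_def, rule_format, OF that] by simp_all
  obtain v where v: "v \<in> pverts G" "depth v = 2" "pred (pred v) = root" "pred v \<noteq> root"
    by (rule depth_2_exists)
  have v0: "v \<noteq> root"
    using v depth_root by auto
  have pv: "pred v \<in> pverts G"
    using pred_arc[OF v(1)] in_arcsD2 by blast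

  have root_ge: "cmod (\<psi> root) \<ge> 1"
  proof -
    let ?f = "\<lambda>u. of_bool (u = root) :: complex"
    have f: "?f \<in> little_lip"
      using of_bool_in_little_lip root_in_verts .
    have eq: "(\<lambda>u. \<psi> u * ?f u) = (\<lambda>u. \<psi> root * of_bool (u = root))"
      by auto
    \<comment> \<open>One from the value at the root, one from the jump at \<open>pred v\<close>,
      whose predecessor is the root.\<close>
    have "1 + 1 \<le> lip_norm ?f"
      using lip_norm_ge[of ?f "pred v"] f pv v by (auto simp: little_lip_def D_def)
    also have "\<dots> = wlip_norm (\<lambda>u. \<psi> root * of_bool (u = root))"
      using N[OF f] eq by simp
    \<comment> \<open>Only neighbours of the root contribute to the supremum, and their weight is
      1.\<close>
    also have "\<dots> \<le> cmod (\<psi> root) + cmod (\<psi> root)"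
      unfolding wlip_norm_def
    proof (intro add_mono cSUP_least verts_nonroot_nonempty)
      fix w assume "w \<in> pverts G - {root}"
      then show "real (depth w) * D (\<lambda>u. \<psi> root * of_bool (u = root)) w \<le> cmod (\<psi> root)"
        using depth_1_iff[of w] D_root_indicator[of w] by auto
    qed simp
    finally show ?thesis
      by simp
  qed

  have "lip_norm (\<lambda>_. 1) = 1"
    using verts_nonroot_nonempty by (simp add: lip_norm_def D_def)
  then have psi: "\<psi> \<in> wlip" "wlip_norm \<psi> = 1"
    using W[OF const_1_in_little_lip] N[OF const_1_in_little_lip] by auto
  have const: "\<psi> w = \<psi> (pred w)" if w: "w \<in> pverts G" "w \<noteq> root" for w
  proof -
    \<comment> \<open>The value at the root already uses up the whole norm 1.\<close>
    have "real (depth w) * D \<psi> w \<le> 0"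
      using wlip_norm_ge[OF psi(1) w] psi(2) root_ge by linarith
    moreover have "depth w > 0"
      using depth_0D w by blast
    ultimately show ?thesis
      by (simp add: D_def mult_le_0_iff)
  qed
  have "\<psi> v = \<psi> root"
    using const v v0 pv by metis
  then have psi_v: "cmod (\<psi> v) \<ge> 1"
    using root_ge by simp

  let ?g = "\<lambda>u. of_bool (u = v) :: complex"
  have g: "?g \<in> little_lip"
    using of_bool_in_little_lip v(1) .
  have "pred v \<noteq> v"
    using pred_arc[OF v(1)] no_loops' by fastforce
  \<comment> \<open>The factor 2 is the depth of \<open>v\<close>; the product vanishes at
    \<open>pred v\<close>, so its jump at \<open>v\<close> is the modulus of
    \<open>\<psi> v\<close>.\<close>
  then have "2 * cmod (\<psi> v) \<le> wlip_norm (\<lambda>u. \<psi> u * ?g u)"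
    using wlip_norm_ge[OF W[OF g] v(1) v0] v(2) v0 by (simp add: D_def)
  also have "\<dots> = lip_norm ?g"
    using N[OF g] .
  also have "\<dots> \<le> 1"
    using v0 D_of_bool_le_1 by (auto simp: lip_norm_def intro!: cSUP_least verts_nonroot_nonempty)
  finally show False
    using psi_v by simp
qed

end

theorem theorem3p2:
  fixes G :: "'a pair_pre_digraph" and r :: 'a
  assumes "rooted_tree G r"
  shows "(\<nexists>\<psi> :: 'a \<Rightarrow> complex. isometry_between (mult_op \<psi>)
             (rooted_tree.lip G r) (rooted_tree.lip_norm G r)
             (rooted_tree.wlip G r) (rooted_tree.wlip_norm G r)) \<and>
         (\<nexists>\<psi> :: 'a \<Rightarrow> complex. isometry_between (mult_op \<psi>)
             (rooted_tree.little_lip G r) (rooted_tree.lip_norm G r)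
             (rooted_tree.little_wlip G r) (rooted_tree.wlip_norm G r))"
proof -
  interpret rooted_tree G r by fact
  have "little_lip \<subseteq> lip" "little_wlip \<subseteq> wlip"
    by (auto simp: little_lip_def little_wlip_def)
  then show ?thesis
    using no_isometry_little_lip_wlip unfolding isometry_between_def by blast
qed

end
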